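(* Let $\widehat{G}$ be a finite group, $G\le\widehat{G}$ a subgroup of index $2$. With the notation of the context, the following two equations hold: \[ \begin{cases} N_I+N_V+N_{IX} = S_v,\\ N_I+N_{IX} = S_w . \end{cases} \] Moreover, their left-hand sides, regarded as linear forms in ten indeterminates $N_I,\dots,N_X$, together with the eight linear forms \[ N_{VII},\quad N_{III}+N_X,\quad N_{IV},\quad N_V+N_{VI},\quad N_I+N_{II}+N_{VIII}+N_{IX}, \] \[ N_I+N_{II}+N_{III},\quad 4N_I+N_{III}+N_V,\quad N_{II}+N_{IX}, \] form a linearly independent family of ten linear forms.
   Context: Let $\widehat{G}$ be a finite group, $G\le\widehat{G}$ a subgroup of index $2$ and $G^\sharp=\widehat{G}\setminus G$. $\mathrm{Irr}(G)$ is the set of complex irreducible characters of $G$. Ten types of characters. For $\chi\in\mathrm{Irr}(G)$ put $\mathcal{F}(\chi)=\frac{1}{|G|}\sum_{g\in G}\chi(g^2)$ and $\mathcal{F}^\sharp(\chi)=\frac1{|G|}\sum_{g\in G^\sharp}\chi(g^2)$, both in $\{-1,0,1\}$, and $\chi^b(z)=\chi(xzx^{-1})$ for $x\in G^\sharp$ (independent of $x$). The type of $\chi$ (position in Dyson's tenfold way) is given by the pair $(\mathcal{F}(\chi),\mathcal{F}^\sharp(\chi))$: type I: $(1,1)$; II: $(1,-1)$; III: $(1,0)$; IV: $(0,0)$ and $\chi^b=\chi$; V: $(0,1)$; VI: $(0,-1)$; VII: $(0,0)$ and $\chi^b\ne\chi$; VIII: $(-1,-1)$; IX: $(-1,1)$;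 X: $(-1,0)$. $N_T$ is the number of $\chi\in\mathrm{Irr}(G)$ of type $T$. $S_v$ and $S_w$ are the numbers of positive elements (counted with multiplicity) of the multisets \[ X_v=\left[\frac{\mathcal{F}^\sharp(\chi)}{\chi(1)} \;\middle|\; \chi\in\mathrm{Irr}(G)\right],\qquad X_w=\left[\frac{\mathcal{F}(\chi)^2\mathcal{F}^\sharp(\chi)}{\chi(1)} \;\middle|\; \chi\in\mathrm{Irr}(G)\right]. \] *)

theory Defs
  imports
    "HOL-Library.Multiset"
    "HOL-Analysis.Finite_Cartesian_Product"
    "Jordan_Normal_Form.VS_Connect"
begin

subsection \<open>Complex representations and irreducible characters\<close>

text \<open>A representation of degree \<open>n\<close> is a homomorphism into \<open>GL\<^sub>n(\<complex>)\<close>.\<close>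

definition representation :: "('a, 'b) monoid_scheme \<Rightarrow> nat \<Rightarrow> ('a \<Rightarrow> complex mat) \<Rightarrow> bool" where
  "representation H n \<rho> \<longleftrightarrow> \<rho> \<in> hom H (units_of (ring_mat TYPE(complex) n ()))"

definition invariant_subspace ::
  "('a, 'b) monoid_scheme \<Rightarrow> nat \<Rightarrow> ('a \<Rightarrow> complex mat) \<Rightarrow> complex Matrix.vec set \<Rightarrow> bool" where
  "invariant_subspace H n \<rho> W \<longleftrightarrow>
     VectorSpace.subspace class_ring W (module_vec TYPE(complex) n) \<and>
     (\<forall>g\<in>carrier H. \<forall>w\<in>W. \<rho> g *\<^sub>v w \<in> W)"

definition irreducible_representation ::
  "('a, 'b) monoid_scheme \<Rightarrow> nat \<Rightarrow> ('a \<Rightarrow> complex mat) \<Rightarrow> bool" where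
  "irreducible_representation H n \<rho> \<longleftrightarrow>
     representation H n \<rho> \<and> n > 0 \<and>
     (\<forall>W. invariant_subspace H n \<rho> W \<longrightarrow> W = {0\<^sub>v n} \<or> W = carrier_vec n)"

definition mat_trace :: "'a::comm_monoid_add mat \<Rightarrow> 'a" where
  "mat_trace A = (\<Sum>i<dim_row A. A $$ (i, i))"

text \<open>Characters are made extensional (\<open>undefined\<close> off the carrier), so that two of them are
  equal as HOL functions iff they agree on the group.\<close>

definition Irr :: "('a, 'b) monoid_scheme \<Rightarrow> ('a \<Rightarrow> complex) set" where
  "Irr H = {\<psi>. \<exists>n \<rho>. irreducible_representation H n \<rho> \<and>
                    \<psi> = (\<lambda>g\<in>carrier H. mat_trace (\<rho> g))}"

subsection \<open>The ten types\<close>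

text \<open>In the following \<open>G\<close> is the carrier of a subgroup of index 2 in the finite group \<open>Ghat\<close>.\<close>

definition IrrSub :: "('a, 'b) monoid_scheme \<Rightarrow> 'a set \<Rightarrow> ('a \<Rightarrow> complex) set" where
  "IrrSub Ghat G = Irr (Ghat\<lparr>carrier := G\<rparr>)"

definition sharp :: "('a, 'b) monoid_scheme \<Rightarrow> 'a set \<Rightarrow> 'a set" where
  "sharp Ghat G = carrier Ghat - G"

definition FS :: "('a, 'b) monoid_scheme \<Rightarrow> 'a set \<Rightarrow> ('a \<Rightarrow> complex) \<Rightarrow> complex" where
  "FS Ghat G \<psi> = (\<Sum>g\<in>G. \<psi> (g [^]\<^bsub>Ghat\<^esub> (2::nat))) / of_nat (card G)"

definition FSsharp :: "('a, 'b) monoid_scheme \<Rightarrow> 'a set \<Rightarrow> ('a \<Rightarrow> complex) \<Rightarrow> complex" where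
  "FSsharp Ghat G \<psi> = (\<Sum>g\<in>sharp Ghat G. \<psi> (g [^]\<^bsub>Ghat\<^esub> (2::nat))) / of_nat (card G)"

text \<open>Conjugation by an element of \<open>sharp Ghat G\<close>. The result does not depend on the chosen \<open>x\<close>, since
  \<open>\<psi>\<close> is a class function on \<open>G\<close>.\<close>

definition char_b :: "('a, 'b) monoid_scheme \<Rightarrow> 'a set \<Rightarrow> ('a \<Rightarrow> complex) \<Rightarrow> ('a \<Rightarrow> complex)" where
  "char_b Ghat G \<psi> =
     (let x = (SOME x. x \<in> sharp Ghat G) in
      (\<lambda>z\<in>G. \<psi> (x \<otimes>\<^bsub>Ghat\<^esub> z \<otimes>\<^bsub>Ghat\<^esub> inv\<^bsub>Ghat\<^esub> x)))"

datatype tenfold = T_I | T_II | T_III | T_IV | T_V | T_VI | T_VII | T_VIII | T_IX | T_X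

lemma UNIV_tenfold: "UNIV = {T_I, T_II, T_III, T_IV, T_V, T_VI, T_VII, T_VIII, T_IX, T_X}"
  using tenfold.exhaust by blast

instance tenfold :: finite
  by standard (simp add: UNIV_tenfold)

fun has_type :: "('a, 'b) monoid_scheme \<Rightarrow> 'a set \<Rightarrow> ('a \<Rightarrow> complex) \<Rightarrow> tenfold \<Rightarrow> bool" where
  "has_type Ghat G \<psi> T_I    \<longleftrightarrow> FS Ghat G \<psi> = 1 \<and> FSsharp Ghat G \<psi> = 1"
| "has_type Ghat G \<psi> T_II   \<longleftrightarrow> FS Ghat G \<psi> = 1 \<and> FSsharp Ghat G \<psi> = - 1"
| "has_type Ghat G \<psi> T_III  \<longleftrightarrow> FS Ghat G \<psi> = 1 \<and> FSsharp Ghat G \<psi> = 0"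
| "has_type Ghat G \<psi> T_IV   \<longleftrightarrow> FS Ghat G \<psi> = 0 \<and> FSsharp Ghat G \<psi> = 0 \<and> char_b Ghat G \<psi> = \<psi>"
| "has_type Ghat G \<psi> T_V    \<longleftrightarrow> FS Ghat G \<psi> = 0 \<and> FSsharp Ghat G \<psi> = 1"
| "has_type Ghat G \<psi> T_VI   \<longleftrightarrow> FS Ghat G \<psi> = 0 \<and> FSsharp Ghat G \<psi> = - 1"
| "has_type Ghat G \<psi> T_VII  \<longleftrightarrow> FS Ghat G \<psi> = 0 \<and> FSsharp Ghat G \<psi> = 0 \<and> char_b Ghat G \<psi> \<noteq> \<psi>"
| "has_type Ghat G \<psi> T_VIII \<longleftrightarrow> FS Ghat G \<psi> = - 1 \<and> FSsharp Ghat G \<psi> = - 1"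
| "has_type Ghat G \<psi> T_IX   \<longleftrightarrow> FS Ghat G \<psi> = - 1 \<and> FSsharp Ghat G \<psi> = 1"
| "has_type Ghat G \<psi> T_X    \<longleftrightarrow> FS Ghat G \<psi> = - 1 \<and> FSsharp Ghat G \<psi> = 0"

definition num_type :: "('a, 'b) monoid_scheme \<Rightarrow> 'a set \<Rightarrow> tenfold \<Rightarrow> nat" where
  "num_type Ghat G T = card {\<psi> \<in> IrrSub Ghat G. has_type Ghat G \<psi> T}"

subsection \<open>The multisets and their positive elements\<close>

definition X_v :: "('a, 'b) monoid_scheme \<Rightarrow> 'a set \<Rightarrow> complex multiset" where
  "X_v Ghat G = {# FSsharp Ghat G \<psi> / \<psi> \<one>\<^bsub>Ghat\<^esub>. \<psi> \<in># mset_set (IrrSub Ghat G) #}"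

definition X_w :: "('a, 'b) monoid_scheme \<Rightarrow> 'a set \<Rightarrow> complex multiset" where
  "X_w Ghat G = {# (FS Ghat G \<psi>)\<^sup>2 * FSsharp Ghat G \<psi> / \<psi> \<one>\<^bsub>Ghat\<^esub>. \<psi> \<in># mset_set (IrrSub Ghat G) #}"

definition num_positive :: "complex multiset \<Rightarrow> nat" where
  "num_positive M = size {# z \<in># M. z \<in> \<real> \<and> Re z > 0 #}"

definition S_v :: "('a, 'b) monoid_scheme \<Rightarrow> 'a set \<Rightarrow> nat" where
  "S_v Ghat G = num_positive (X_v Ghat G)"

definition S_w :: "('a, 'b) monoid_scheme \<Rightarrow> 'a set \<Rightarrow> nat" where
  "S_w Ghat G = num_positive (X_w Ghat G)"

subsection \<open>Linear forms in ten indeterminates\<close>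

text \<open>A linear form is represented by its coefficient vector, the indeterminates being the
  standard basis vectors.\<close>

definition indet :: "tenfold \<Rightarrow> real ^ tenfold" where
  "indet T = axis T 1"

definition independent_family :: "'v::real_vector list \<Rightarrow> bool" where
  "independent_family L \<longleftrightarrow> distinct L \<and> independent (set L)"

end

theory Submission
  imports Defs "Jordan_Normal_Form.Spectral_Radius" "HOL-Analysis.Linear_Algebra"
begin

text \<open>Both indicators are instances of the twisted sum
  \<open>1/|G| \<Sum>\<^bsub>h\<in>G\<^esub> \<chi>((h x)\<^sup>2)\<close> with \<open>x\<close> normalising \<open>G\<close> and \<open>x\<^sup>2 \<in> G\<close>: take \<open>x = 1\<close> for the
  Frobenius-Schur indicator and any \<open>x\<close> outside \<open>G\<close> for the sharp one. Put \<open>\<sigma>(h) = \<rho>(x h x\<^sup>-\<^sup>1)\<close> and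
  \<open>A = \<rho>(x\<^sup>2)\<close>. By Schur's lemma the matrices \<open>X\<close> with \<open>\<rho>(h) X \<sigma>(h)\<^sup>T = X\<close> form a space of dimension at
  most one. If it is zero, averaging matrix units shows that the sum vanishes. If it is spanned by
  \<open>B\<close>, then \<open>X \<mapsto> A\<^sup>-\<^sup>1 X\<^sup>T\<close> preserves it, so \<open>B\<^sup>T = c A B\<close>; applying this twice gives \<open>c\<^sup>2 = 1\<close>, and
  averaging matrix units shows that the sum is \<open>c\<close>. Hence both indicators lie in \<open>{-1, 0, 1}\<close>, so a
  positive element of \<open>X\<^sub>v\<close> or \<open>X\<^sub>w\<close> is exactly one with sharp indicator 1 (and nonzero indicator for
  \<open>X\<^sub>w\<close>). There are finitely many characters because they are orthogonal functions on \<open>G\<close>. The ten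
  linear forms are independent because they span.\<close>

section \<open>Matrix preliminaries: finiteness of biorthogonal families, and cyclicity of the
  trace\<close>

text \<open>More members of \<open>Y\<close> than points of \<open>X\<close> would give a square
  matrix \<open>A\<close> that is singular and yet satisfies
  \<open>A * B = c \<cdot>\<^sub>m 1\<^sub>m N\<close> with \<open>c \<noteq> 0\<close>. The second
  family \<open>v\<close> lets a character be paired with the inverted argument of another
  one.\<close>

lemma finite_biorthogonal_family:
  fixes u v :: "'i \<Rightarrow> 'x \<Rightarrow> 'k::field"
  assumes X: "finite X" and c: "c \<noteq> 0"
    and uv: "\<And>p q. p \<in> Y \<Longrightarrow> q \<in> Y \<Longrightarrow> (\<Sum>x\<in>X. u p x * v q x) = (if p = q then c else 0)"
  shows "finite Y"
proof (rule ccontr)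
  assume "infinite Y"
  define M where "M = card X"
  define N where "N = Suc M"
  obtain Z where Z: "Z \<subseteq> Y" "finite Z" "card Z = N"
    using \<open>infinite Y\<close> infinite_arbitrarily_large by blast
  obtain y where y: "bij_betw y {0..<N} Z" using ex_bij_betw_nat_finite[OF Z(2)] Z(3) by metis
  obtain x where x: "bij_betw x {0..<M} X" using ex_bij_betw_nat_finite[OF X] M_def by metis
  \<comment> \<open>Since \<open>N = Suc M\<close>, the column of index \<open>M\<close> corresponds
    to no point of \<open>X\<close>. Padding it with zeros makes \<open>A\<close> square and
    singular without changing the product with \<open>B\<close>.\<close>
  define A where "A = mat N N (\<lambda>(i, j). if j < M then u (y i) (x j) else 0)"
  define B where "B = mat N N (\<lambda>(j, i). if j < M then v (y i) (x j) else 0)"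
  have car: "A \<in> carrier_mat N N" "B \<in> carrier_mat N N" by (auto simp: A_def B_def)
  have "A *\<^sub>v unit_vec N M = 0\<^sub>v N"
    by (rule eq_vecI) (auto simp: A_def N_def)
  then have "det A = 0"
    using det_0_iff_vec_prod_zero[OF car(1)] unit_vec_nonzero[of M N] by (force simp: N_def)
  moreover have "A * B = c \<cdot>\<^sub>m 1\<^sub>m N"
  proof (rule eq_matI)
    fix i k assume ik: "i < dim_row (c \<cdot>\<^sub>m 1\<^sub>m N)" "k < dim_col (c \<cdot>\<^sub>m 1\<^sub>m N)"
    then have "(A * B) $$ (i, k) = (\<Sum>j = 0..<N. A $$ (i, j) * B $$ (j, k))"
      using car by (simp add: scalar_prod_def)
    also have "\<dots> = (\<Sum>j = 0..<M. u (y i) (x j) * v (y k) (x j))"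
      using ik by (simp add: A_def B_def N_def)
    also have "\<dots> = (\<Sum>z\<in>X. u (y i) z * v (y k) z)"
      by (rule sum.reindex_bij_betw[OF x])
    also have "\<dots> = (if y i = y k then c else 0)"
      using ik Z(1) y by (intro uv) (auto simp: bij_betw_def)
    also have "\<dots> = (c \<cdot>\<^sub>m 1\<^sub>m N) $$ (i, k)"
      using ik y by (auto simp: bij_betw_def inj_on_def)
    finally show "(A * B) $$ (i, k) = (c \<cdot>\<^sub>m 1\<^sub>m N) $$ (i, k)" .
  qed (use car in auto)
  ultimately show False
    using det_mult[OF car] c by (simp add: det_smult)
qed

lemma mat_trace_mult_comm:
  fixes A B :: "'a::comm_semiring_0 mat"
  assumes "A \<in> carrier_mat n m" "B \<in> carrier_mat m n"
  shows "mat_trace (A * B) = mat_trace (B * A)"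
proof -
  have "mat_trace (A * B) = (\<Sum>i<n. \<Sum>j<m. A $$ (i, j) * B $$ (j, i))"
    using assms by (simp add: mat_trace_def scalar_prod_def atLeast0LessThan)
  also have "\<dots> = (\<Sum>j<m. \<Sum>i<n. B $$ (j, i) * A $$ (i, j))"
    by (subst sum.swap) (simp add: mult.commute)
  also have "\<dots> = mat_trace (B * A)"
    using assms by (simp add: mat_trace_def scalar_prod_def atLeast0LessThan)
  finally show ?thesis .
qed

subsection \<open>Schur's lemma\<close>

lemma representation_carrier:
  "representation H n \<rho> \<Longrightarrow> g \<in> carrier H \<Longrightarrow> \<rho> g \<in> carrier_mat n n"
  by (auto simp: representation_def hom_def units_of_def Units_def ring_mat_simps)

lemma representation_mult:
  "representation H n \<rho> \<Longrightarrow> g \<in> carrier H \<Longrightarrow> h \<in> carrier H \<Longrightarrow> \<rho> (g \<otimes>\<^bsub>H\<^esub> h) = \<rho> g * \<rho> h"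
  by (auto simp: representation_def hom_def units_of_def ring_mat_simps)

lemma representation_one:
  assumes "group H" "representation H n \<rho>"
  shows "\<rho> \<one>\<^bsub>H\<^esub> = 1\<^sub>m n"
proof -
  interpret R: ring "ring_mat TYPE(complex) n ()" by (rule ring_mat)
  interpret group_hom H "units_of (ring_mat TYPE(complex) n ())" \<rho>
    using assms by (simp add: group_hom_def group_hom_axioms_def representation_def R.units_group)
  show ?thesis using hom_one by (simp add: units_of_def ring_mat_simps)
qed

lemma representation_inv:
  assumes "group H" "representation H n \<rho>" "g \<in> carrier H"
  shows "\<rho> g * \<rho> (inv\<^bsub>H\<^esub> g) = 1\<^sub>m n" "\<rho> (inv\<^bsub>H\<^esub> g) * \<rho> g = 1\<^sub>m n"
  using assms representation_mult[OF assms(2), of g "inv\<^bsub>H\<^esub> g"]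
    representation_mult[OF assms(2), of "inv\<^bsub>H\<^esub> g" g] representation_one[OF assms(1,2)]
  by (simp_all add: group.inv_closed group.r_inv group.l_inv)

lemma invariant_subspaceI:
  assumes "W \<subseteq> carrier_vec n" "0\<^sub>v n \<in> W"
    and "\<And>v w. v \<in> W \<Longrightarrow> w \<in> W \<Longrightarrow> v + w \<in> W"
    and "\<And>c v. v \<in> W \<Longrightarrow> c \<cdot>\<^sub>v v \<in> W"
    and "\<And>g w. g \<in> carrier H \<Longrightarrow> w \<in> W \<Longrightarrow> \<rho> g *\<^sub>v w \<in> W"
  shows "invariant_subspace H n \<rho> W"
proof -
  interpret vec_space "TYPE(complex)" n .
  have "VectorSpace.subspace class_ring W V"
    using assms(1-4)
    by (intro subspace.intro submodule.intro) (auto simp: vec_vs vec_module module_vec_simps)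
  then show ?thesis using assms(5) by (auto simp: invariant_subspace_def)
qed

lemma irreducible_representationD:
  assumes "irreducible_representation H n \<rho>"
  shows "representation H n \<rho>" "0 < n"
    "invariant_subspace H n \<rho> W \<Longrightarrow> W = {0\<^sub>v n} \<or> W = carrier_vec n"
  using assms by (auto simp: irreducible_representation_def)

lemma mult_mat_unit_vec:
  fixes A :: "'k::comm_semiring_1 mat"
  shows "A \<in> carrier_mat n m \<Longrightarrow> j < m \<Longrightarrow> A *\<^sub>v unit_vec m j = col A j"
  by (intro eq_vecI) auto

text \<open>The image of \<open>T\<close> is an invariant subspace and is nonzero, hence everything;
  preimages of the unit vectors are the columns of \<open>S\<close>. The family
  \<open>\<beta>\<close> is arbitrary so that the lemma also fits families known only through matrix
  identities.\<close>

lemma schur_right_inverse: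
  assumes irr: "irreducible_representation H n \<rho>"
    and T: "T \<in> carrier_mat n m" "T \<noteq> 0\<^sub>m n m"
    and \<beta>: "\<And>g. g \<in> carrier H \<Longrightarrow> \<beta> g \<in> carrier_mat m m"
    and tw: "\<And>g. g \<in> carrier H \<Longrightarrow> \<rho> g * T = T * \<beta> g"
  obtains S where "S \<in> carrier_mat m n" "T * S = 1\<^sub>m n"
proof -
  note rep = irreducible_representationD(1)[OF irr]
  define W where "W = {T *\<^sub>v v | v. v \<in> carrier_vec m}"
  have "invariant_subspace H n \<rho> W"
  proof (rule invariant_subspaceI)
    show "W \<subseteq> carrier_vec n" using T by (auto simp: W_def)
    have "T *\<^sub>v 0\<^sub>v m = 0\<^sub>v n" using T by auto
    then show "0\<^sub>v n \<in> W" unfolding W_def by (metis (mono_tags, lifting) mem_Collect_eq zero_carrier_vec)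
  next
    fix v w assume "v \<in> W" "w \<in> W"
    then obtain a b where "a \<in> carrier_vec m" "b \<in> carrier_vec m" "v = T *\<^sub>v a" "w = T *\<^sub>v b"
      by (auto simp: W_def)
    then show "v + w \<in> W"
      using mult_add_distrib_mat_vec[OF T(1), of a b] by (auto simp: W_def intro!: exI[of _ "a + b"])
  next
    fix c v assume "v \<in> W"
    then obtain a where "a \<in> carrier_vec m" "v = T *\<^sub>v a" by (auto simp: W_def)
    then show "c \<cdot>\<^sub>v v \<in> W"
      using mult_mat_vec[OF T(1), of a c] by (auto simp: W_def intro!: exI[of _ "c \<cdot>\<^sub>v a"])
  next
    fix g w assume g: "g \<in> carrier H" and "w \<in> W"
    then obtain a where a: "a \<in> carrier_vec m" "w = T *\<^sub>v a" by (auto simp: W_def)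
    have "\<rho> g *\<^sub>v w = \<rho> g * T *\<^sub>v a"
      using assoc_mult_mat_vec[OF representation_carrier[OF rep g] T(1) a(1)] a by simp
    also have "\<dots> = T *\<^sub>v (\<beta> g *\<^sub>v a)"
      using assoc_mult_mat_vec[OF T(1) \<beta>[OF g] a(1)] tw[OF g] by simp
    finally show "\<rho> g *\<^sub>v w \<in> W" using \<beta>[OF g] a by (auto simp: W_def)
  qed
  then consider "W = {0\<^sub>v n}" | "W = carrier_vec n"
    using irreducible_representationD(3)[OF irr] by blast
  then show thesis
  proof cases
    case 1
    have "col T j = 0\<^sub>v n" if "j < m" for j
    proof -
      have "T *\<^sub>v unit_vec m j \<in> W" by (auto simp: W_def)
      then show ?thesis using 1 mult_mat_unit_vec[OF T(1) that] by simp
    qed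
    then have "T = 0\<^sub>m n m"
      using T by (intro eq_matI) (auto simp: vec_eq_iff col_def)
    with T show thesis by simp
  next
    case 2
    have "\<exists>v. v \<in> carrier_vec m \<and> T *\<^sub>v v = unit_vec n j" for j
    proof -
      have "unit_vec n j \<in> W" using 2 by simp
      then show ?thesis by (auto simp: W_def)
    qed
    then obtain s where s: "\<And>j. j < n \<Longrightarrow> s j \<in> carrier_vec m" "\<And>j. j < n \<Longrightarrow> T *\<^sub>v s j = unit_vec n j"
      by metis
    define S where "S = mat m n (\<lambda>(i, j). s j $ i)"
    have S: "S \<in> carrier_mat m n" by (simp add: S_def)
    have col: "col S j = s j" if "j < n" for j
      using s(1)[OF that] that by (auto simp: S_def)
    have "T * S = 1\<^sub>m n"
    proof (rule mat_col_eqI)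
      fix j assume "j < dim_col (1\<^sub>m n)"
      then show "col (T * S) j = col (1\<^sub>m n) j"
        using col_mult2[OF T(1) S] col s(2) by simp
    qed (use T S in auto)
    with S show thesis by (rule that)
  qed
qed

text \<open>The kernel of \<open>T\<close> is invariant under \<open>\<sigma>\<close>, and it is
  proper because \<open>T\<close> is nonzero, so irreducibility makes it trivial.\<close>

lemma schur_injective:
  assumes irr: "irreducible_representation H m \<sigma>"
    and T: "T \<in> carrier_mat n m" "T \<noteq> 0\<^sub>m n m"
    and \<alpha>: "\<And>g. g \<in> carrier H \<Longrightarrow> \<alpha> g \<in> carrier_mat n n"
    and tw: "\<And>g. g \<in> carrier H \<Longrightarrow> \<alpha> g * T = T * \<sigma> g"
    and v: "v \<in> carrier_vec m" "T *\<^sub>v v = 0\<^sub>v n"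
  shows "v = 0\<^sub>v m"
proof -
  note rep = irreducible_representationD(1)[OF irr]
  define W where "W = {v \<in> carrier_vec m. T *\<^sub>v v = 0\<^sub>v n}"
  have "invariant_subspace H m \<sigma> W"
  proof (rule invariant_subspaceI)
    fix v w assume "v \<in> W" "w \<in> W"
    then show "v + w \<in> W" using mult_add_distrib_mat_vec[OF T(1), of v w] by (auto simp: W_def)
  next
    fix c v assume "v \<in> W"
    then show "c \<cdot>\<^sub>v v \<in> W" using mult_mat_vec[OF T(1), of v c] by (auto simp: W_def)
  next
    fix g w assume g: "g \<in> carrier H" and w: "w \<in> W"
    have "T *\<^sub>v (\<sigma> g *\<^sub>v w) = \<alpha> g * T *\<^sub>v w"
      using assoc_mult_mat_vec[OF T(1) representation_carrier[OF rep g]] w tw[OF g] by (simp add: W_def)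
    also have "\<dots> = \<alpha> g *\<^sub>v 0\<^sub>v n"
      using assoc_mult_mat_vec[OF \<alpha>[OF g] T(1)] w by (simp add: W_def)
    also have "\<dots> = 0\<^sub>v n" using \<alpha>[OF g] by auto
    finally show "\<sigma> g *\<^sub>v w \<in> W"
      using representation_carrier[OF rep g] w by (auto simp: W_def)
  qed (use T in \<open>auto simp: W_def\<close>)
  moreover have "W \<noteq> carrier_vec m"
  proof
    assume W: "W = carrier_vec m"
    have "T = 0\<^sub>m n m"
    proof (rule eq_matI)
      fix i j assume ij: "i < dim_row (0\<^sub>m n m)" "j < dim_col (0\<^sub>m n m)"
      then have Tij: "T $$ (i, j) = (T *\<^sub>v unit_vec m j) $ i" using T by auto
      have "unit_vec m j \<in> W" by (simp add: W)
      then have "T *\<^sub>v unit_vec m j = 0\<^sub>v n" by (simp add: W_def)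
      with Tij show "T $$ (i, j) = 0\<^sub>m n m $$ (i, j)" using ij by simp
    qed (use T in auto)
    with T show False by simp
  qed
  ultimately have "W = {0\<^sub>v m}" using irreducible_representationD(3)[OF irr] by blast
  with v show ?thesis by (auto simp: W_def)
qed

text \<open>Over the complex numbers \<open>X\<close> has an eigenvalue \<open>c\<close>. The matrix
  \<open>char_matrix X c\<close>, that is \<open>X\<close> minus the scalar \<open>c\<close>, still
  commutes with \<open>\<rho>\<close> and kills an eigenvector, so it vanishes by
  \<open>schur_injective\<close>.\<close>

lemma schur_scalar:
  assumes irr: "irreducible_representation H n \<rho>"
    and X: "X \<in> carrier_mat n n"
    and comm: "\<And>g. g \<in> carrier H \<Longrightarrow> \<rho> g * X = X * \<rho> g"
  obtains c where "X = c \<cdot>\<^sub>m 1\<^sub>m n"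
proof -
  note rep = irreducible_representationD(1)[OF irr]
  obtain c v where "eigenvector X v c"
    using spectrum_non_empty[OF X irreducible_representationD(2)[OF irr]]
    by (auto simp: spectrum_def eigenvalue_def)
  then have v: "v \<in> carrier_vec n" "v \<noteq> 0\<^sub>v n" "char_matrix X c *\<^sub>v v = 0\<^sub>v n"
    using eigenvector_char_matrix[OF X] by auto
  have "char_matrix X c = 0\<^sub>m n n"
  proof (rule ccontr)
    assume "char_matrix X c \<noteq> 0\<^sub>m n n"
    moreover have "\<rho> g * char_matrix X c = char_matrix X c * \<rho> g" if "g \<in> carrier H" for g
      using representation_carrier[OF rep that] X comm[OF that]
      by (simp add: char_matrix_def mult_add_distrib_mat[of _ n n _ n] add_mult_distrib_mat[of _ n n _ _ n]
          mult_smult_distrib[of _ n n _ n] mult_smult_assoc_mat[of _ n n _ n])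
    ultimately show False
      using schur_injective[where \<alpha> = \<rho>, OF irr char_matrix_closed[OF X]]
        representation_carrier[OF rep] v by blast
  qed
  moreover have "X = char_matrix X c + c \<cdot>\<^sub>m 1\<^sub>m n"
    using X by (intro eq_matI) (auto simp: char_matrix_def)
  ultimately show thesis by (intro that[of c]) auto
qed

section \<open>Averages of matrix units over the group\<close>

text \<open>The unnormalised average of \<open>\<alpha>(g) E\<^sub>j\<^sub>k \<beta>(g)\<close>, where \<open>E\<^sub>j\<^sub>k\<close> is a matrix unit.\<close>

definition entry_average ::
  "('a, 'b) monoid_scheme \<Rightarrow> nat \<Rightarrow> nat \<Rightarrow> ('a \<Rightarrow> complex mat) \<Rightarrow> ('a \<Rightarrow> complex mat) \<Rightarrow> nat \<Rightarrow> nat \<Rightarrow> complex mat"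
  where "entry_average H n m \<alpha> \<beta> j k =
    mat n m (\<lambda>(i, l). \<Sum>g\<in>carrier H. \<alpha> g $$ (i, j) * \<beta> g $$ (k, l))"

lemma entry_average_carrier [simp]: "entry_average H n m \<alpha> \<beta> j k \<in> carrier_mat n m"
  by (simp add: entry_average_def)

lemma sum_group_translate:
  assumes "group H" "h \<in> carrier H"
  shows "(\<Sum>g\<in>carrier H. f (h \<otimes>\<^bsub>H\<^esub> g)) = (\<Sum>g\<in>carrier H. f g)"
proof -
  interpret group H by fact
  have "bij_betw (\<lambda>g. h \<otimes>\<^bsub>H\<^esub> g) (carrier H) (carrier H)"
    using assms(2) by (intro bij_betw_byWitness[where f' = "\<lambda>g. inv\<^bsub>H\<^esub> h \<otimes>\<^bsub>H\<^esub> g"])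
      (auto simp: m_assoc[symmetric])
  then show ?thesis by (rule sum.reindex_bij_betw)
qed

text \<open>Multiplying by \<open>\<alpha> h\<close> and \<open>\<beta> h\<close> turns the summand
  at \<open>g\<close> into the one at \<open>h \<otimes> g\<close>, and the sum is invariant under
  translation. The map \<open>\<beta>\<close> reverses products, which covers both uses: the
  transpose of a representation, and a representation at the inverse.\<close>

lemma entry_average_invariant:
  assumes H: "group H" "h \<in> carrier H"
    and \<alpha>: "\<And>g. g \<in> carrier H \<Longrightarrow> \<alpha> g \<in> carrier_mat n n"
    and \<beta>: "\<And>g. g \<in> carrier H \<Longrightarrow> \<beta> g \<in> carrier_mat m m"
    and \<alpha>_mult: "\<And>g. g \<in> carrier H \<Longrightarrow> \<alpha> (h \<otimes>\<^bsub>H\<^esub> g) = \<alpha> h * \<alpha> g"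
    and \<beta>_mult: "\<And>g. g \<in> carrier H \<Longrightarrow> \<beta> (h \<otimes>\<^bsub>H\<^esub> g) = \<beta> g * \<beta> h"
    and jk: "j < n" "k < m"
  shows "\<alpha> h * entry_average H n m \<alpha> \<beta> j k * \<beta> h = entry_average H n m \<alpha> \<beta> j k" (is "_ * ?T * _ = _")
proof (rule eq_matI)
  have car: "\<alpha> h \<in> carrier_mat n n" "\<beta> h \<in> carrier_mat m m" using \<alpha> \<beta> H by auto
  fix i l assume "i < dim_row ?T" "l < dim_col ?T"
  then have il: "i < n" "l < m" by (simp_all add: entry_average_def)
  have "(\<alpha> h * ?T * \<beta> h) $$ (i, l) =
      (\<Sum>q<m. \<Sum>p<n. \<Sum>g\<in>carrier H. (\<alpha> h $$ (i, p) * \<alpha> g $$ (p, j)) * (\<beta> g $$ (k, q) * \<beta> h $$ (q, l)))"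
    using car il by (simp add: entry_average_def scalar_prod_def sum_distrib_left sum_distrib_right
        atLeast0LessThan mult.assoc)
  also have "\<dots> = (\<Sum>q<m. \<Sum>g\<in>carrier H. \<Sum>p<n.
      (\<alpha> h $$ (i, p) * \<alpha> g $$ (p, j)) * (\<beta> g $$ (k, q) * \<beta> h $$ (q, l)))"
    by (rule sum.cong[OF refl], rule sum.swap)
  also have "\<dots> = (\<Sum>g\<in>carrier H. \<Sum>q<m. \<Sum>p<n.
      (\<alpha> h $$ (i, p) * \<alpha> g $$ (p, j)) * (\<beta> g $$ (k, q) * \<beta> h $$ (q, l)))"
    by (rule sum.swap)
  also have "\<dots> = (\<Sum>g\<in>carrier H. \<alpha> (h \<otimes>\<^bsub>H\<^esub> g) $$ (i, j) * \<beta> (h \<otimes>\<^bsub>H\<^esub> g) $$ (k, l))"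
  proof (rule sum.cong[OF refl])
    fix g assume g: "g \<in> carrier H"
    have "(\<Sum>q<m. \<Sum>p<n. (\<alpha> h $$ (i, p) * \<alpha> g $$ (p, j)) * (\<beta> g $$ (k, q) * \<beta> h $$ (q, l)))
        = (\<Sum>p<n. \<alpha> h $$ (i, p) * \<alpha> g $$ (p, j)) * (\<Sum>q<m. \<beta> g $$ (k, q) * \<beta> h $$ (q, l))"
      unfolding sum_product by (rule sum.swap)
    also have "\<dots> = (\<alpha> h * \<alpha> g) $$ (i, j) * (\<beta> g * \<beta> h) $$ (k, l)"
      using car \<alpha>[OF g] \<beta>[OF g] il jk by (simp add: scalar_prod_def atLeast0LessThan)
    finally show "(\<Sum>q<m. \<Sum>p<n. (\<alpha> h $$ (i, p) * \<alpha> g $$ (p, j)) * (\<beta> g $$ (k, q) * \<beta> h $$ (q, l)))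
        = \<alpha> (h \<otimes>\<^bsub>H\<^esub> g) $$ (i, j) * \<beta> (h \<otimes>\<^bsub>H\<^esub> g) $$ (k, l)"
      using \<alpha>_mult[OF g] \<beta>_mult[OF g] by simp
  qed
  also have "\<dots> = (\<Sum>g\<in>carrier H. \<alpha> g $$ (i, j) * \<beta> g $$ (k, l))"
    by (rule sum_group_translate[OF H])
  finally show "(\<alpha> h * ?T * \<beta> h) $$ (i, l) = ?T $$ (i, l)"
    using il by (simp add: entry_average_def)
qed (use \<alpha>[OF H(2)] \<beta>[OF H(2)] in \<open>auto simp: entry_average_def\<close>)

text \<open>Cancelling \<open>Q\<close> on the right turns invariance, which is what averaging
  produces, into the intertwining relation that Schur's lemma expects.\<close>

lemma intertwine_of_invariant:
  fixes P X Q Q' :: "'k::semiring_1 mat"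
  assumes "P \<in> carrier_mat n n" "X \<in> carrier_mat n m" "Q \<in> carrier_mat m m" "Q' \<in> carrier_mat m m"
    and "P * X * Q = X" "Q * Q' = 1\<^sub>m m"
  shows "P * X = X * Q'"
proof -
  have "X * Q' = P * X * (Q * Q')"
    using assms(1-4) by (subst assms(5)[symmetric]) (simp add: assoc_mult_mat[of _ n m _ m _ m] assoc_mult_mat[of _ n n _ m _ m])
  then show ?thesis using assms(6) right_mult_one_mat[OF mult_carrier_mat[OF assms(1,2)]] by simp
qed

subsection \<open>Twisted Frobenius-Schur indicators\<close>

text \<open>By cyclicity the trace of \<open>D * \<alpha> g * E * \<beta> g\<close>, with
  \<open>E\<close> the matrix unit at \<open>(j, k)\<close>, is the entry \<open>(k, j)\<close> of
  \<open>\<beta> g * D * \<alpha> g\<close>. This determines the scalar whenever an average is known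
  to be a multiple of a fixed matrix.\<close>

lemma mat_trace_entry_average:
  assumes D: "D \<in> carrier_mat m n" and jk: "j < n" "k < m"
    and \<alpha>: "\<And>g. g \<in> carrier H \<Longrightarrow> \<alpha> g \<in> carrier_mat n n"
    and \<beta>: "\<And>g. g \<in> carrier H \<Longrightarrow> \<beta> g \<in> carrier_mat m m"
  shows "mat_trace (D * entry_average H n m \<alpha> \<beta> j k) = (\<Sum>g\<in>carrier H. (\<beta> g * D * \<alpha> g) $$ (k, j))"
proof -
  have "mat_trace (D * entry_average H n m \<alpha> \<beta> j k)
      = (\<Sum>l<m. \<Sum>i<n. \<Sum>g\<in>carrier H. \<beta> g $$ (k, l) * D $$ (l, i) * \<alpha> g $$ (i, j))"
    using D by (simp add: mat_trace_def scalar_prod_def entry_average_def sum_distrib_left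
        atLeast0LessThan mult_ac)
  also have "\<dots> = (\<Sum>l<m. \<Sum>g\<in>carrier H. \<Sum>i<n. \<beta> g $$ (k, l) * D $$ (l, i) * \<alpha> g $$ (i, j))"
    by (rule sum.cong[OF refl], rule sum.swap)
  also have "\<dots> = (\<Sum>g\<in>carrier H. \<Sum>l<m. \<Sum>i<n. \<beta> g $$ (k, l) * D $$ (l, i) * \<alpha> g $$ (i, j))"
    by (rule sum.swap)
  also have "\<dots> = (\<Sum>g\<in>carrier H. (\<beta> g * D * \<alpha> g) $$ (k, j))"
  proof (rule sum.cong[OF refl])
    fix g assume "g \<in> carrier H"
    then have "\<alpha> g \<in> carrier_mat n n" "\<beta> g \<in> carrier_mat m m" using \<alpha> \<beta> by auto
    then show "(\<Sum>l<m. \<Sum>i<n. \<beta> g $$ (k, l) * D $$ (l, i) * \<alpha> g $$ (i, j)) = (\<beta> g * D * \<alpha> g) $$ (k, j)"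
      using D jk by (simp add: scalar_prod_def sum_distrib_left atLeast0LessThan mult.assoc)
  qed
  finally show ?thesis .
qed

lemma mat_trace_mult3:
  fixes P Q R :: "'k::comm_semiring_0 mat"
  assumes "P \<in> carrier_mat n n" "Q \<in> carrier_mat n n" "R \<in> carrier_mat n n"
  shows "mat_trace (P * Q * R) = (\<Sum>i<n. \<Sum>k<n. \<Sum>j<n. P $$ (i, j) * Q $$ (j, k) * R $$ (k, i))"
  using assms by (simp add: mat_trace_def scalar_prod_def sum_distrib_left atLeast0LessThan mult.assoc)
    (intro sum.cong refl sum.swap)

lemma smult_smult_mat: "a \<cdot>\<^sub>m (b \<cdot>\<^sub>m M) = (a * b :: 'k::semigroup_mult) \<cdot>\<^sub>m M"
  by (rule eq_matI) (auto simp: mult.assoc)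

lemma mat_trace_smult_one: "mat_trace (c \<cdot>\<^sub>m 1\<^sub>m n :: complex mat) = of_nat n * c"
  by (simp add: mat_trace_def)

text \<open>Schur's lemma makes \<open>B\<close> invertible, and its inverse \<open>D\<close> is
  invariant with the two sides exchanged. For any other invariant \<open>X\<close> the product
  \<open>X * D\<close> commutes with \<open>\<rho>\<close>, hence is a scalar \<open>c\<close>, and
  \<open>X = X * D * B\<close> is \<open>c\<close> times \<open>B\<close>.\<close>

lemma invariant_matrix_unique:
  assumes irr: "irreducible_representation H n \<rho>"
    and \<beta>: "\<And>h. h \<in> carrier H \<Longrightarrow> \<beta> h \<in> carrier_mat n n" "\<And>h. h \<in> carrier H \<Longrightarrow> \<beta>' h \<in> carrier_mat n n"
      "\<And>h. h \<in> carrier H \<Longrightarrow> \<beta> h * \<beta>' h = 1\<^sub>m n"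
    and B: "B \<in> carrier_mat n n" "B \<noteq> 0\<^sub>m n n" "\<And>h. h \<in> carrier H \<Longrightarrow> \<rho> h * B * \<beta> h = B"
  obtains D where "D \<in> carrier_mat n n" "B * D = 1\<^sub>m n" "D * B = 1\<^sub>m n"
    "\<And>h. h \<in> carrier H \<Longrightarrow> \<beta> h * D * \<rho> h = D"
    "\<And>X. X \<in> carrier_mat n n \<Longrightarrow> (\<And>h. h \<in> carrier H \<Longrightarrow> \<rho> h * X * \<beta> h = X) \<Longrightarrow> \<exists>c. X = c \<cdot>\<^sub>m B"
proof -
  note rep = irreducible_representationD(1)[OF irr]
  note assoc = assoc_mult_mat[of _ n n _ n _ n] mult_carrier_mat[of _ n n _ n]
  have tw: "\<rho> h * X = X * \<beta>' h"
    if "X \<in> carrier_mat n n" "\<And>h. h \<in> carrier H \<Longrightarrow> \<rho> h * X * \<beta> h = X" "h \<in> carrier H" for X h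
    using intertwine_of_invariant[OF representation_carrier[OF rep that(3)] that(1) \<beta>(1,2)[OF that(3)]
        that(2)[OF that(3)] \<beta>(3)[OF that(3)]] .
  obtain D where D: "D \<in> carrier_mat n n" "B * D = 1\<^sub>m n"
    using schur_right_inverse[OF irr B(1,2) \<beta>(2) tw[OF B(1,3)]] by blast
  have DB: "D * B = 1\<^sub>m n" using mat_mult_left_right_inverse[OF B(1) D] .
  \<comment> \<open>This is the relation \<open>\<rho> h * B = B * \<beta>' h\<close> multiplied by
    \<open>D\<close> on both sides.\<close>
  have D\<rho>: "D * \<rho> h = \<beta>' h * D" if h: "h \<in> carrier H" for h
  proof -
    note car = representation_carrier[OF rep h] \<beta>(2)[OF h] B(1) D(1)
    have "D * \<rho> h = D * (\<rho> h * B) * D" using car D(2) by (simp add: assoc)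
    also have "\<dots> = (D * B) * (\<beta>' h * D)" using car by (simp only: tw[OF B(1,3) h]) (simp add: assoc)
    finally show ?thesis using car by (simp add: DB)
  qed
  show thesis
  proof (rule that[OF D DB])
    fix h assume h: "h \<in> carrier H"
    note car = representation_carrier[OF rep h] \<beta>(1,2)[OF h] D(1)
    have "\<beta> h * D * \<rho> h = (\<beta> h * \<beta>' h) * D" using car by (simp add: assoc D\<rho>[OF h])
    then show "\<beta> h * D * \<rho> h = D" using D(1) by (simp add: \<beta>(3)[OF h])
  next
    fix X assume X: "X \<in> carrier_mat n n" "\<And>h. h \<in> carrier H \<Longrightarrow> \<rho> h * X * \<beta> h = X"
    have "\<rho> h * (X * D) = X * D * \<rho> h" if h: "h \<in> carrier H" for h
    proof -
      note car = representation_carrier[OF rep h] \<beta>(2)[OF h] D(1) X(1)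
      have "\<rho> h * (X * D) = X * \<beta>' h * D" using car by (simp add: tw[OF X h, symmetric] assoc)
      then show ?thesis using car by (simp add: assoc D\<rho>[OF h])
    qed
    then obtain c where c: "X * D = c \<cdot>\<^sub>m 1\<^sub>m n"
      using schur_scalar[OF irr mult_carrier_mat[OF X(1) D(1)]] by metis
    have "X = X * D * B" using X(1) D(1) B(1) DB by (simp add: assoc)
    also have "\<dots> = c \<cdot>\<^sub>m B" unfolding c using B(1) by (simp add: mult_smult_assoc_mat[of _ n n _ n])
    finally show "\<exists>c. X = c \<cdot>\<^sub>m B" ..
  qed
qed

text \<open>The pair \<open>\<tau>\<close>, \<open>a\<close> stands for conjugation by an element
  \<open>x\<close> and its square, so that \<open>h \<otimes> \<tau> h \<otimes> a\<close> is the
  square of \<open>h\<close> times \<open>x\<close>. In this form \<open>x\<close> itself may lie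
  outside \<open>H\<close>; what remains of it is that \<open>\<tau>\<close> fixes \<open>a\<close>
  and that \<open>\<tau>\<close> applied twice is conjugation by \<open>a\<close>.\<close>

theorem twisted_frobenius_schur:
  fixes H (structure)
  assumes H: "group H" "finite (carrier H)" and irr: "irreducible_representation H n \<rho>"
    and \<tau>: "\<tau> \<in> hom H H" and a: "a \<in> carrier H" "\<tau> a = a"
    and \<tau>\<tau>: "\<And>h. h \<in> carrier H \<Longrightarrow> \<tau> (\<tau> h) = a \<otimes> h \<otimes> inv a"
  shows "(\<Sum>h\<in>carrier H. mat_trace (\<rho> (h \<otimes> \<tau> h \<otimes> a))) / of_nat (card (carrier H)) \<in> {-1, 0, 1}"
proof -
  interpret H: group H by fact
  note rep = irreducible_representationD(1)[OF irr]
  note assoc = assoc_mult_mat[of _ n n _ n _ n] mult_carrier_mat[of _ n n _ n]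
  define N where "N = (of_nat (card (carrier H)) :: complex)"
  have N: "N \<noteq> 0" using H(2) H.one_closed by (auto simp: N_def)
  have n: "n > 0" by (rule irreducible_representationD(2)[OF irr])
  define A where "A = \<rho> a"
  define \<sigma> where "\<sigma> = (\<lambda>h. \<rho> (\<tau> h))"
  have \<tau>_closed: "\<tau> h \<in> carrier H" if "h \<in> carrier H" for h using \<tau> that by (auto simp: hom_def)
  have \<rho>: "\<rho> h \<in> carrier_mat n n" if "h \<in> carrier H" for h by (rule representation_carrier[OF rep that])
  have \<sigma>: "\<sigma> h \<in> carrier_mat n n" if "h \<in> carrier H" for h using \<rho> \<tau>_closed that by (simp add: \<sigma>_def)
  have A: "A \<in> carrier_mat n n" using \<rho> a by (simp add: A_def)
  have \<rho>_mult: "\<rho> (g \<otimes> h) = \<rho> g * \<rho> h" if "g \<in> carrier H" "h \<in> carrier H" for g h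
    by (rule representation_mult[OF rep that])
  have \<sigma>_mult: "\<sigma> (g \<otimes> h) = \<sigma> g * \<sigma> h" if "g \<in> carrier H" "h \<in> carrier H" for g h
    using \<tau> that \<rho>_mult \<tau>_closed by (simp add: \<sigma>_def hom_mult)
  have \<tau>_one: "\<tau> \<one> = \<one>" by (rule hom_one[OF \<tau> H(1) H(1)])
  have \<sigma>_inv: "(\<sigma> h)\<^sup>T * (\<sigma> (inv h))\<^sup>T = 1\<^sub>m n" if "h \<in> carrier H" for h
  proof -
    have "\<sigma> (inv h) * \<sigma> h = 1\<^sub>m n"
      using that \<sigma>_mult[of "inv h" h] \<tau>_one representation_one[OF H(1) rep] by (simp add: \<sigma>_def)
    then have "(\<sigma> (inv h) * \<sigma> h)\<^sup>T = 1\<^sub>m n" by simp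
    then show ?thesis using transpose_mult[of "\<sigma> (inv h)" n n "\<sigma> h" n] \<sigma> that by simp
  qed
  define T where "T = entry_average H n n \<rho> (\<lambda>h. (\<sigma> h)\<^sup>T)"
  have T: "T j k \<in> carrier_mat n n" for j k by (simp add: T_def)
  have T_inv: "\<rho> h * T j k * (\<sigma> h)\<^sup>T = T j k" if "h \<in> carrier H" "j < n" "k < n" for h j k
    unfolding T_def using that \<rho> \<sigma> \<rho>_mult \<sigma>_mult
    by (intro entry_average_invariant[OF H(1)]) (auto simp: transpose_mult[of _ n n _ n])
  define S where "S = (\<Sum>h\<in>carrier H. mat_trace (\<rho> (h \<otimes> \<tau> h \<otimes> a)))"
  \<comment> \<open>The trace of \<open>\<rho> h * \<sigma> h * A\<close> is written out in entries
    and the sum over the group moved innermost, where it becomes the entry \<open>(i, j)\<close> of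
    the invariant matrix \<open>T j k\<close>.\<close>
  have "S = (\<Sum>h\<in>carrier H. \<Sum>i<n. \<Sum>k<n. \<Sum>j<n. \<rho> h $$ (i, j) * \<sigma> h $$ (j, k) * A $$ (k, i))"
    unfolding S_def using a \<tau>_closed \<rho> \<sigma> A
    by (intro sum.cong refl) (simp add: \<rho>_mult mat_trace_mult3[symmetric] A_def \<sigma>_def)
  also have "\<dots> = (\<Sum>i<n. \<Sum>h\<in>carrier H. \<Sum>k<n. \<Sum>j<n. \<rho> h $$ (i, j) * \<sigma> h $$ (j, k) * A $$ (k, i))"
    by (rule sum.swap)
  also have "\<dots> = (\<Sum>i<n. \<Sum>k<n. \<Sum>h\<in>carrier H. \<Sum>j<n. \<rho> h $$ (i, j) * \<sigma> h $$ (j, k) * A $$ (k, i))"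
    by (intro sum.cong refl sum.swap)
  also have "\<dots> = (\<Sum>i<n. \<Sum>k<n. \<Sum>j<n. \<Sum>h\<in>carrier H. \<rho> h $$ (i, j) * \<sigma> h $$ (j, k) * A $$ (k, i))"
    by (intro sum.cong refl sum.swap)
  also have "\<dots> = (\<Sum>i<n. \<Sum>k<n. \<Sum>j<n. T j k $$ (i, j) * A $$ (k, i))"
  proof (intro sum.cong refl)
    fix i k j assume "i \<in> {..<n}" "k \<in> {..<n}" "j \<in> {..<n}"
    moreover have "(\<sigma> h)\<^sup>T $$ (k, j) = \<sigma> h $$ (j, k)" if "h \<in> carrier H" for h
      using carrier_matD[OF \<sigma>[OF that]] calculation by simp
    ultimately show "(\<Sum>h\<in>carrier H. \<rho> h $$ (i, j) * \<sigma> h $$ (j, k) * A $$ (k, i)) = T j k $$ (i, j) * A $$ (k, i)"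
      by (simp add: T_def entry_average_def sum_distrib_right)
  qed
  finally have S: "S = (\<Sum>i<n. \<Sum>k<n. \<Sum>j<n. T j k $$ (i, j) * A $$ (k, i))" .
  show ?thesis
  proof (cases "\<forall>j<n. \<forall>k<n. T j k = 0\<^sub>m n n")
    case True
    then have "S = 0" using S by simp
    then show ?thesis by (simp add: S_def)
  next
    case False
    then obtain B where B: "B \<in> carrier_mat n n" "B \<noteq> 0\<^sub>m n n" "\<And>h. h \<in> carrier H \<Longrightarrow> \<rho> h * B * (\<sigma> h)\<^sup>T = B"
      using T T_inv by blast
    have \<sigma>T: "(\<sigma> h)\<^sup>T \<in> carrier_mat n n" "(\<sigma> (inv h))\<^sup>T \<in> carrier_mat n n" if "h \<in> carrier H" for h
      using \<sigma> that by auto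
    obtain D where D: "D \<in> carrier_mat n n" "B * D = 1\<^sub>m n" "D * B = 1\<^sub>m n"
      and D_inv: "\<And>h. h \<in> carrier H \<Longrightarrow> (\<sigma> h)\<^sup>T * D * \<rho> h = D"
      and uniq: "\<And>X. X \<in> carrier_mat n n \<Longrightarrow> (\<And>h. h \<in> carrier H \<Longrightarrow> \<rho> h * X * (\<sigma> h)\<^sup>T = X) \<Longrightarrow> \<exists>c. X = c \<cdot>\<^sub>m B"
      using invariant_matrix_unique[OF irr \<sigma>T \<sigma>_inv B] by blast
    \<comment> \<open>\<open>T j k\<close> is a multiple of \<open>B\<close>, and the trace of
      \<open>D * T j k\<close>, which is \<open>n\<close> times the factor, identifies it. Keeping
      \<open>n\<close> on the left avoids a division.\<close>
    have T_eq: "of_nat n \<cdot>\<^sub>m T j k = (N * D $$ (k, j)) \<cdot>\<^sub>m B" if jk: "j < n" "k < n" for j k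
    proof -
      obtain l where l: "T j k = l \<cdot>\<^sub>m B" using uniq[OF T] T_inv jk by blast
      have "D * T j k = l \<cdot>\<^sub>m 1\<^sub>m n" using D B(1) by (simp add: l mult_smult_distrib[of _ n n _ n])
      then have "of_nat n * l = mat_trace (D * T j k)" by (simp only: mat_trace_smult_one)
      also have "\<dots> = (\<Sum>h\<in>carrier H. ((\<sigma> h)\<^sup>T * D * \<rho> h) $$ (k, j))"
        unfolding T_def using D(1) jk \<rho> \<sigma>T by (intro mat_trace_entry_average) auto
      also have "\<dots> = N * D $$ (k, j)" by (simp add: D_inv N_def)
      finally have "of_nat n * l = N * D $$ (k, j)" .
      then show ?thesis by (simp add: l smult_smult_mat)
    qed
    \<comment> \<open>Transposing the invariance of \<open>B\<close> exchanges \<open>\<rho>\<close>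
      and \<open>\<sigma>\<close>. At \<open>\<tau> h\<close> this gives invariance of
      \<open>B\<^sup>T\<close> with \<open>\<rho>\<close> evaluated at the conjugate of
      \<open>h\<close> by \<open>a\<close>, and the factor \<open>\<rho> (inv a)\<close> undoes that
      conjugation.\<close>
    have X_inv: "\<rho> h * (\<rho> (inv a) * B\<^sup>T) * (\<sigma> h)\<^sup>T = \<rho> (inv a) * B\<^sup>T" if h: "h \<in> carrier H" for h
    proof -
      have BT: "\<sigma> g * B\<^sup>T * (\<rho> g)\<^sup>T = B\<^sup>T" if "g \<in> carrier H" for g
      proof -
        have "(\<rho> g * B * (\<sigma> g)\<^sup>T)\<^sup>T = \<sigma> g * (B\<^sup>T * (\<rho> g)\<^sup>T)"
          using \<rho> \<sigma> B(1) that by (simp add: transpose_mult[of _ n n _ n] assoc)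
        then show ?thesis using B(3)[OF that] \<rho> \<sigma> B(1) that by (simp add: assoc)
      qed
      have "\<sigma> (\<tau> h) = \<rho> (a \<otimes> h \<otimes> inv a)" using \<tau>\<tau> h by (simp add: \<sigma>_def)
      then have "\<rho> (a \<otimes> h \<otimes> inv a) * B\<^sup>T * (\<sigma> h)\<^sup>T = B\<^sup>T"
        using BT[OF \<tau>_closed[OF h]] by (simp add: \<sigma>_def)
      then have "\<rho> (inv a) * B\<^sup>T = \<rho> (inv a) * (\<rho> (a \<otimes> h \<otimes> inv a) * B\<^sup>T * (\<sigma> h)\<^sup>T)" by simp
      also have "\<dots> = \<rho> (inv a \<otimes> (a \<otimes> h \<otimes> inv a)) * B\<^sup>T * (\<sigma> h)\<^sup>T"
        using \<rho> \<sigma>T B(1) a h by (simp add: \<rho>_mult assoc)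
      also have "inv a \<otimes> (a \<otimes> h \<otimes> inv a) = h \<otimes> inv a"
        using a h by (simp add: H.m_assoc[symmetric])
      also have "\<rho> (h \<otimes> inv a) * B\<^sup>T * (\<sigma> h)\<^sup>T = \<rho> h * (\<rho> (inv a) * B\<^sup>T) * (\<sigma> h)\<^sup>T"
        using \<rho> \<sigma>T B(1) a h by (simp add: \<rho>_mult assoc)
      finally show ?thesis by simp
    qed
    obtain c where c: "\<rho> (inv a) * B\<^sup>T = c \<cdot>\<^sub>m B"
      using uniq[OF _ X_inv] \<rho> a B(1) by (metis H.inv_closed mult_carrier_mat transpose_carrier_mat)
    have BT: "B\<^sup>T = c \<cdot>\<^sub>m (A * B)"
    proof -
      have "B\<^sup>T = (A * \<rho> (inv a)) * B\<^sup>T"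
        using representation_inv(1)[OF H(1) rep a(1)] B(1) by (simp add: A_def)
      also have "\<dots> = A * (c \<cdot>\<^sub>m B)"
        using \<rho>[of "inv a"] a A B(1) by (simp add: assoc c[symmetric])
      finally show ?thesis using A B(1) by (simp add: mult_smult_distrib[of _ n n _ n])
    qed
    \<comment> \<open>Because \<open>\<tau>\<close> fixes \<open>a\<close>, invariance of
      \<open>B\<close> at \<open>a\<close> reads \<open>A * B * A\<^sup>T = B\<close>. Together with
      \<open>BT\<close> this yields \<open>BA\<close>.\<close>
    have "\<sigma> a = A" using a by (simp add: \<sigma>_def A_def)
    then have BA: "B\<^sup>T * A\<^sup>T = c \<cdot>\<^sub>m B"
      using B(3)[OF a(1)] A B(1) by (simp add: BT A_def[symmetric] mult_smult_assoc_mat[of _ n n _ n])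
    \<comment> \<open>Transposing \<open>BA\<close> gives a second relation between
      \<open>A * B\<close> and \<open>B\<^sup>T\<close>. Combined with \<open>BT\<close> it forces
      \<open>c * c = 1\<close>, read off at a nonzero entry of \<open>B\<close>.\<close>
    have "A * B = (B\<^sup>T * A\<^sup>T)\<^sup>T"
      using A B(1) by (simp add: transpose_mult[of _ n n _ n])
    also have "\<dots> = c \<cdot>\<^sub>m B\<^sup>T" unfolding BA by (rule eq_matI) auto
    finally have "A * B = c \<cdot>\<^sub>m B\<^sup>T" .
    then have "B\<^sup>T = c \<cdot>\<^sub>m (c \<cdot>\<^sub>m B\<^sup>T)" using BT by metis
    then have cc: "B\<^sup>T = (c * c) \<cdot>\<^sub>m B\<^sup>T" by (simp only: smult_smult_mat)
    obtain p q where pq: "p < n" "q < n" "B $$ (p, q) \<noteq> 0"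
      using B(1,2) by (metis carrier_matD eq_matI index_zero_mat)
    have "B $$ (p, q) = c * c * B $$ (p, q)"
      using arg_cong[OF cc, of "\<lambda>M. M $$ (q, p)"] pq B(1) by simp
    with pq have "c * c = 1" by simp
    then have c1: "c = 1 \<or> c = -1" by (simp add: square_eq_1_iff)
    have nT: "of_nat n * T j k $$ (i, j) = N * D $$ (k, j) * B $$ (i, j)" if "i < n" "j < n" "k < n" for i j k
      using arg_cong[OF T_eq[OF that(2,3)], of "\<lambda>M. M $$ (i, j)"] that T[of j k] B(1) by simp
    \<comment> \<open>Inserting \<open>nT\<close> turns the sum into \<open>N\<close> times the
      trace of \<open>D * B\<^sup>T * A\<^sup>T\<close>. By \<open>BA\<close> that product is
      \<open>c\<close> times \<open>D * B\<close>, the scalar matrix \<open>c\<close>.\<close>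
    have "of_nat n * S = (\<Sum>i<n. \<Sum>k<n. \<Sum>j<n. (of_nat n * T j k $$ (i, j)) * A $$ (k, i))"
      by (simp add: S sum_distrib_left mult.assoc)
    also have "\<dots> = (\<Sum>i<n. \<Sum>k<n. \<Sum>j<n. N * D $$ (k, j) * B $$ (i, j) * A $$ (k, i))"
      by (simp add: nT)
    also have "\<dots> = N * (\<Sum>k<n. \<Sum>i<n. \<Sum>j<n. D $$ (k, j) * B\<^sup>T $$ (j, i) * A\<^sup>T $$ (i, k))"
      using A B(1) by (subst sum.swap) (simp add: sum_distrib_left mult.assoc)
    also have "\<dots> = N * mat_trace (D * B\<^sup>T * A\<^sup>T)"
      using A B(1) D(1) by (subst mat_trace_mult3[of D n]) auto
    also have "D * B\<^sup>T * A\<^sup>T = c \<cdot>\<^sub>m 1\<^sub>m n"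
      using A B(1) D by (simp add: assoc BA mult_smult_distrib[of _ n n _ n])
    finally have "S = N * c" using n by (simp add: mat_trace_smult_one)
    then show ?thesis using c1 N by (auto simp: S_def[symmetric] N_def[symmetric])
  qed
qed

subsection \<open>Orthogonality of characters\<close>

text \<open>A product of traces is a sum of products of diagonal entries, and summing
  \<open>\<alpha> g $$ (i, i) * \<beta> g $$ (k, k)\<close> over the group gives one entry of an
  average. Character sums are thereby reduced to Schur's lemma.\<close>

lemma sum_mat_trace_mult:
  assumes \<alpha>: "\<And>g. g \<in> carrier H \<Longrightarrow> \<alpha> g \<in> carrier_mat n n"
    and \<beta>: "\<And>g. g \<in> carrier H \<Longrightarrow> \<beta> g \<in> carrier_mat m m"
  shows "(\<Sum>g\<in>carrier H. mat_trace (\<alpha> g) * mat_trace (\<beta> g))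
    = (\<Sum>i<n. \<Sum>k<m. entry_average H n m \<alpha> \<beta> i k $$ (i, k))"
proof -
  have "(\<Sum>g\<in>carrier H. mat_trace (\<alpha> g) * mat_trace (\<beta> g))
      = (\<Sum>g\<in>carrier H. \<Sum>i<n. \<Sum>k<m. \<alpha> g $$ (i, i) * \<beta> g $$ (k, k))"
    by (intro sum.cong refl) (simp add: mat_trace_def sum_product carrier_matD[OF \<alpha>] carrier_matD[OF \<beta>])
  also have "\<dots> = (\<Sum>i<n. \<Sum>g\<in>carrier H. \<Sum>k<m. \<alpha> g $$ (i, i) * \<beta> g $$ (k, k))"
    by (rule sum.swap)
  also have "\<dots> = (\<Sum>i<n. \<Sum>k<m. \<Sum>g\<in>carrier H. \<alpha> g $$ (i, i) * \<beta> g $$ (k, k))"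
    by (intro sum.cong refl sum.swap)
  finally show ?thesis by (simp add: entry_average_def)
qed

lemma entry_average_intertwines:
  assumes H: "group H" and \<rho>: "representation H n \<rho>" and \<sigma>: "representation H m \<sigma>"
    and jk: "j < n" "k < m"
  shows "h \<in> carrier H \<Longrightarrow>
    \<rho> h * entry_average H n m \<rho> (\<lambda>g. \<sigma> (inv\<^bsub>H\<^esub> g)) j k = entry_average H n m \<rho> (\<lambda>g. \<sigma> (inv\<^bsub>H\<^esub> g)) j k * \<sigma> h"
proof -
  interpret group H by fact
  assume h: "h \<in> carrier H"
  show ?thesis
  proof (rule intertwine_of_invariant[where n = n and m = m])
    show "\<rho> h * entry_average H n m \<rho> (\<lambda>g. \<sigma> (inv\<^bsub>H\<^esub> g)) j k * \<sigma> (inv\<^bsub>H\<^esub> h)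
        = entry_average H n m \<rho> (\<lambda>g. \<sigma> (inv\<^bsub>H\<^esub> g)) j k"
      using h jk representation_carrier[OF \<rho>] representation_carrier[OF \<sigma>]
      by (intro entry_average_invariant[OF H])
        (auto simp: representation_mult[OF \<rho>] representation_mult[OF \<sigma>, symmetric] inv_mult_group)
  qed (use h representation_carrier[OF \<rho>] representation_carrier[OF \<sigma>] representation_inv(2)[OF H \<sigma>] in auto)
qed

text \<open>A nonzero sum provides a nonzero average, hence an intertwiner \<open>T\<close> with a
  two-sided inverse \<open>S\<close>; cyclicity of the trace then compares the characters. The
  degrees \<open>n\<close> and \<open>m\<close> need not be compared beforehand.\<close>

lemma mat_trace_eq_of_character_sum_nonzero:
  assumes H: "group H" and \<rho>: "irreducible_representation H n \<rho>" and \<sigma>: "irreducible_representation H m \<sigma>"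
    and nz: "(\<Sum>g\<in>carrier H. mat_trace (\<rho> g) * mat_trace (\<sigma> (inv\<^bsub>H\<^esub> g))) \<noteq> 0"
    and h: "h \<in> carrier H"
  shows "mat_trace (\<rho> h) = mat_trace (\<sigma> h)"
proof -
  interpret group H by fact
  note rep = irreducible_representationD(1)[OF \<rho>] irreducible_representationD(1)[OF \<sigma>]
  let ?E = "entry_average H n m \<rho> (\<lambda>g. \<sigma> (inv\<^bsub>H\<^esub> g))"
  have "(\<Sum>i<n. \<Sum>k<m. ?E i k $$ (i, k)) \<noteq> 0"
    using nz representation_carrier[OF rep(1)] representation_carrier[OF rep(2)]
    by (subst (asm) sum_mat_trace_mult[of H \<rho> n "\<lambda>g. \<sigma> (inv\<^bsub>H\<^esub> g)" m]) auto
  then obtain i where "i < n" "(\<Sum>k<m. ?E i k $$ (i, k)) \<noteq> 0"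
    by (metis (no_types, lifting) lessThan_iff sum.neutral)
  then obtain k where ik: "i < n" "k < m" "?E i k $$ (i, k) \<noteq> 0"
    by (metis (no_types, lifting) lessThan_iff sum.neutral)
  define T where "T = ?E i k"
  have T: "T \<in> carrier_mat n m" "T \<noteq> 0\<^sub>m n m" using ik by (auto simp: T_def)
  have tw: "\<rho> g * T = T * \<sigma> g" if "g \<in> carrier H" for g
    unfolding T_def by (rule entry_average_intertwines[OF H rep ik(1,2) that])
  obtain S where S: "S \<in> carrier_mat m n" "T * S = 1\<^sub>m n"
    using schur_right_inverse[OF \<rho> T representation_carrier[OF rep(2)] tw] by blast
  \<comment> \<open>Since \<open>T * S\<close> is the identity, \<open>T\<close> sends
    \<open>S * T\<close> applied to a unit vector and the unit vector itself to the same vector, and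
    \<open>T\<close> is injective.\<close>
  have "S * T = 1\<^sub>m m"
  proof (rule eq_matI)
    fix p q assume "p < dim_row (1\<^sub>m m :: complex mat)" "q < dim_col (1\<^sub>m m :: complex mat)"
    then have pq: "p < m" "q < m" by auto
    define w where "w = S *\<^sub>v (T *\<^sub>v unit_vec m q)"
    have w: "w \<in> carrier_vec m" using S T by (auto simp: w_def intro!: mult_mat_vec_carrier)
    have Tu: "T *\<^sub>v unit_vec m q \<in> carrier_vec n" using T by auto
    have "T *\<^sub>v w = T *\<^sub>v unit_vec m q"
      using assoc_mult_mat_vec[OF T(1) S(1) Tu] Tu by (simp add: S(2) w_def)
    then have "T *\<^sub>v (w - unit_vec m q) = 0\<^sub>v n"
      using mult_minus_distrib_mat_vec[OF T(1) w unit_vec_carrier[of m q]] Tu by simp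
    then have "w - unit_vec m q = 0\<^sub>v m"
      using schur_injective[OF \<sigma> T representation_carrier[OF rep(1)] tw] w by simp
    then have "w $ p - unit_vec m q $ p = 0" using w pq by (metis index_minus_vec(1) index_unit_vec(3) index_zero_vec(1))
    moreover have "w = col (S * T) q"
      using assoc_mult_mat_vec[OF S(1) T(1) unit_vec_carrier[of m q]]
        mult_mat_unit_vec[OF mult_carrier_mat[OF S(1) T(1)] pq(2)] by (simp add: w_def)
    ultimately show "(S * T) $$ (p, q) = 1\<^sub>m m $$ (p, q)" using pq S(1) T(1) by simp
  qed (use S T in auto)
  have \<rho>h: "\<rho> h \<in> carrier_mat n n" and \<sigma>h: "\<sigma> h \<in> carrier_mat m m"
    using representation_carrier[OF rep(1) h] representation_carrier[OF rep(2) h] by auto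
  have "\<rho> h = \<rho> h * T * S" using \<rho>h S T assoc_mult_mat[OF \<rho>h T(1) S(1)] by simp
  also have "\<dots> = T * \<sigma> h * S" by (simp add: tw[OF h])
  also have "mat_trace \<dots> = mat_trace (S * (T * \<sigma> h))"
    using mat_trace_mult_comm[of "T * \<sigma> h" n m S] T S \<sigma>h by simp
  also have "S * (T * \<sigma> h) = \<sigma> h"
    using assoc_mult_mat[OF S(1) T(1) \<sigma>h] \<sigma>h by (simp add: \<open>S * T = 1\<^sub>m m\<close>)
  finally show ?thesis .
qed

text \<open>Each average of a matrix unit is now a scalar matrix. Its trace vanishes off the
  diagonal and equals the group order on it, so the \<open>n\<close> diagonal terms add up to
  \<open>n\<close> times the order.\<close>

lemma character_sum_self:
  assumes H: "group H" and \<rho>: "irreducible_representation H n \<rho>"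
  shows "(\<Sum>g\<in>carrier H. mat_trace (\<rho> g) * mat_trace (\<rho> (inv\<^bsub>H\<^esub> g))) = of_nat (card (carrier H))"
proof -
  interpret group H by fact
  note rep = irreducible_representationD(1)[OF \<rho>]
  let ?E = "entry_average H n n \<rho> (\<lambda>g. \<rho> (inv\<^bsub>H\<^esub> g))"
  have E: "of_nat n * ?E i k $$ (i, k) = (if i = k then of_nat (card (carrier H)) else 0)"
    if ik: "i < n" "k < n" for i k
  proof -
    obtain c where c: "?E i k = c \<cdot>\<^sub>m 1\<^sub>m n"
      using schur_scalar[OF \<rho> entry_average_carrier entry_average_intertwines[OF H rep rep ik]] by blast
    have "of_nat n * c = mat_trace (1\<^sub>m n * ?E i k)" by (simp add: c mat_trace_smult_one)
    also have "\<dots> = (\<Sum>g\<in>carrier H. (\<rho> (inv\<^bsub>H\<^esub> g) * 1\<^sub>m n * \<rho> g) $$ (k, i))"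
      using ik representation_carrier[OF rep] by (intro mat_trace_entry_average) auto
    also have "\<dots> = (\<Sum>g\<in>carrier H. 1\<^sub>m n $$ (k, i))"
    proof (rule sum.cong[OF refl])
      fix g assume g: "g \<in> carrier H"
      then have "\<rho> (inv\<^bsub>H\<^esub> g) * 1\<^sub>m n = \<rho> (inv\<^bsub>H\<^esub> g)"
        using representation_carrier[OF rep] by (intro right_mult_one_mat) auto
      then show "(\<rho> (inv\<^bsub>H\<^esub> g) * 1\<^sub>m n * \<rho> g) $$ (k, i) = 1\<^sub>m n $$ (k, i)"
        by (simp add: representation_inv(2)[OF H rep g])
    qed
    finally show ?thesis using ik c by auto
  qed
  have "of_nat n * (\<Sum>g\<in>carrier H. mat_trace (\<rho> g) * mat_trace (\<rho> (inv\<^bsub>H\<^esub> g)))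
      = (\<Sum>i<n. \<Sum>k<n. of_nat n * ?E i k $$ (i, k))"
    using representation_carrier[OF rep] by (subst sum_mat_trace_mult) (auto simp: sum_distrib_left)
  also have "\<dots> = of_nat n * of_nat (card (carrier H))" by (simp add: E)
  finally show ?thesis using irreducible_representationD(2)[OF \<rho>] by simp
qed

text \<open>Pairing each character with the inverted argument of another makes \<open>Irr H\<close>
  a biorthogonal family of functions on a finite set. Using inverses in place of complex conjugates
  dispenses with unitarity.\<close>

theorem finite_Irr:
  assumes H: "group H" "finite (carrier H)"
  shows "finite (Irr H)"
proof (rule finite_biorthogonal_family[OF H(2)])
  interpret group H by fact
  show "(of_nat (card (carrier H)) :: complex) \<noteq> 0" using H(2) one_closed by auto
  fix \<phi> \<psi> assume "\<phi> \<in> Irr H" "\<psi> \<in> Irr H"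
  then obtain n \<rho> m \<sigma> where \<rho>: "irreducible_representation H n \<rho>" "\<phi> = (\<lambda>g\<in>carrier H. mat_trace (\<rho> g))"
    and \<sigma>: "irreducible_representation H m \<sigma>" "\<psi> = (\<lambda>g\<in>carrier H. mat_trace (\<sigma> g))"
    by (auto simp: Irr_def)
  show "(\<Sum>g\<in>carrier H. \<phi> g * \<psi> (inv\<^bsub>H\<^esub> g)) = (if \<phi> = \<psi> then of_nat (card (carrier H)) else 0)"
  proof (cases "\<phi> = \<psi>")
    case True
    have "(\<Sum>g\<in>carrier H. \<phi> g * \<psi> (inv\<^bsub>H\<^esub> g)) = (\<Sum>g\<in>carrier H. mat_trace (\<rho> g) * mat_trace (\<rho> (inv\<^bsub>H\<^esub> g)))"
      by (simp add: True[symmetric] \<rho>(2))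
    then show ?thesis using True character_sum_self[OF H(1) \<rho>(1)] by simp
  next
    case False
    \<comment> \<open>Characters are extensional, so two different ones already differ at a group
      element.\<close>
    then obtain h where "h \<in> carrier H" "mat_trace (\<rho> h) \<noteq> mat_trace (\<sigma> h)"
      by (auto simp: \<rho>(2) \<sigma>(2) restrict_def fun_eq_iff split: if_splits)
    then have "(\<Sum>g\<in>carrier H. mat_trace (\<rho> g) * mat_trace (\<sigma> (inv\<^bsub>H\<^esub> g))) = 0"
      using mat_trace_eq_of_character_sum_nonzero[OF H(1) \<rho>(1) \<sigma>(1)] by blast
    then show ?thesis using False by (simp add: \<rho>(2) \<sigma>(2))
  qed
qed

subsection \<open>The two indicators of a subgroup of index 2\<close>

text \<open>\<open>twisted_frobenius_schur\<close> is applied inside \<open>G\<close> with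
  \<open>\<tau>\<close> the conjugation by \<open>x\<close> and \<open>a\<close> equal to
  \<open>x \<otimes> x\<close>; after cancellation
  \<open>h \<otimes> \<tau> h \<otimes> (x \<otimes> x)\<close> is the square of
  \<open>h \<otimes> x\<close>.\<close>

lemma twisted_indicator_values:
  fixes Ghat (structure)
  assumes Ghat: "group Ghat" "finite (carrier Ghat)" and G: "subgroup G Ghat"
    and x: "x \<in> carrier Ghat" "x \<otimes> x \<in> G" "\<And>g. g \<in> G \<Longrightarrow> x \<otimes> g \<otimes> inv x \<in> G"
    and \<psi>: "\<psi> \<in> IrrSub Ghat G"
  shows "(\<Sum>h\<in>G. \<psi> ((h \<otimes> x) [^] (2::nat))) / of_nat (card G) \<in> {-1, 0, 1}"
proof -
  interpret Ghat: group Ghat by fact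
  interpret G: subgroup G Ghat by fact
  define H where "H = Ghat\<lparr>carrier := G\<rparr>"
  have H_simps [simp]: "carrier H = G" "a \<otimes>\<^bsub>H\<^esub> b = a \<otimes> b" for a b by (simp_all add: H_def)
  have H: "group H" unfolding H_def by (rule G.subgroup_is_group[OF Ghat(1)])
  have fin: "finite G" using Ghat(2) G.subset finite_subset by blast
  have inv_H: "inv\<^bsub>H\<^esub> a = inv a" if "a \<in> G" for a
    using Ghat.m_inv_consistent[OF G that] by (simp add: H_def)
  obtain n \<rho> where irr: "irreducible_representation H n \<rho>" and \<psi>_eq: "\<psi> = (\<lambda>g\<in>G. mat_trace (\<rho> g))"
    using \<psi> by (auto simp: IrrSub_def Irr_def H_def)
  define \<tau> where "\<tau> = (\<lambda>h. x \<otimes> h \<otimes> inv x)"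
  note [simp] = Ghat.m_assoc Ghat.inv_mult_group
  have cancel: "inv x \<otimes> (x \<otimes> h) = h" if "h \<in> carrier Ghat" for h
    using x(1) that by (simp add: Ghat.m_assoc[symmetric] del: Ghat.m_assoc)
  have "(\<Sum>h\<in>carrier H. mat_trace (\<rho> (h \<otimes>\<^bsub>H\<^esub> \<tau> h \<otimes>\<^bsub>H\<^esub> (x \<otimes> x)))) / of_nat (card (carrier H)) \<in> {-1, 0, 1}"
  proof (rule twisted_frobenius_schur[OF H _ irr])
    show "\<tau> \<in> hom H H"
      using x by (auto simp: hom_def \<tau>_def cancel simp del: Ghat.inv_mult_group)
  qed (use x fin in \<open>auto simp: \<tau>_def cancel inv_H\<close>)
  moreover have "\<psi> ((h \<otimes> x) [^] (2::nat)) = mat_trace (\<rho> (h \<otimes>\<^bsub>H\<^esub> \<tau> h \<otimes>\<^bsub>H\<^esub> (x \<otimes> x)))" if h: "h \<in> G" for h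
  proof -
    have "h \<otimes> \<tau> h \<otimes> (x \<otimes> x) \<in> G" using h x by (simp add: \<tau>_def del: Ghat.m_assoc)
    moreover have "h \<otimes> \<tau> h \<otimes> (x \<otimes> x) = (h \<otimes> x) [^] (2::nat)"
      using h x by (simp add: \<tau>_def numeral_2_eq_2 cancel)
    ultimately show ?thesis by (simp add: \<psi>_eq)
  qed
  ultimately show ?thesis by simp
qed

lemma FS_values:
  assumes "group Ghat" "finite (carrier Ghat)" "subgroup G Ghat" "\<psi> \<in> IrrSub Ghat G"
  shows "FS Ghat G \<psi> \<in> {-1, 0, 1}"
proof -
  interpret Ghat: group Ghat by fact
  interpret G: subgroup G Ghat by fact
  have "(\<Sum>h\<in>G. \<psi> ((h \<otimes>\<^bsub>Ghat\<^esub> \<one>\<^bsub>Ghat\<^esub>) [^]\<^bsub>Ghat\<^esub> (2::nat))) / of_nat (card G) \<in> {-1, 0, 1}"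
    by (rule twisted_indicator_values[OF assms(1-3) _ _ _ assms(4)]) auto
  then show ?thesis by (simp add: FS_def cong: sum.cong)
qed

text \<open>With exactly two right cosets, the one other than \<open>G\<close> is disjoint from
  \<open>G\<close> and contains every element outside it, so it is the complement; it is also the
  coset of each of its elements.\<close>

lemma
  fixes Ghat (structure)
  assumes Ghat: "group Ghat" and G: "subgroup G Ghat" and index: "card (rcosets G) = 2"
  shows index2_sharp_nonempty: "sharp Ghat G \<noteq> {}"
    and index2_sharp_eq: "x \<in> sharp Ghat G \<Longrightarrow> sharp Ghat G = (\<lambda>h. h \<otimes> x) ` G"
proof -
  interpret Ghat: group Ghat by fact
  interpret G: subgroup G Ghat by fact
  have G_coset: "G \<in> rcosets G" using G.subgroup_in_rcosets[OF Ghat] .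
  obtain C where C: "rcosets G = {G, C}" "C \<noteq> G"
    using index G_coset unfolding card_2_iff by (metis insertE insert_commute singletonD)
  have coset: "y \<in> C" if "y \<in> sharp Ghat G" for y
  proof -
    have "G #> y \<in> rcosets G" "y \<in> G #> y"
      using that Ghat.rcosetsI[OF G.subset] Ghat.rcos_self[OF _ G] by (auto simp: sharp_def)
    then show ?thesis using C that by (auto simp: sharp_def)
  qed
  have disj: "C \<inter> G = {}"
    using Ghat.rcos_disjoint[OF G] C by (auto simp: pairwise_def disjnt_def)
  have "C \<subseteq> carrier Ghat" using Ghat.rcosets_part_G[OF G] C by auto
  with disj coset have sharp: "sharp Ghat G = C" by (auto simp: sharp_def)
  show "sharp Ghat G \<noteq> {}"
    using C(1) G.rcosets_non_empty[of C] sharp by auto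
  assume x: "x \<in> sharp Ghat G"
  then have "G #> x \<in> rcosets G" "x \<in> G #> x"
    using Ghat.rcosetsI[OF G.subset] Ghat.rcos_self[OF _ G] by (auto simp: sharp_def)
  then have "G #> x = C" using C x by (auto simp: sharp_def)
  then show "sharp Ghat G = (\<lambda>h. h \<otimes> x) ` G" unfolding sharp by (auto simp: r_coset_def)
qed

text \<open>The complement of \<open>G\<close> is the coset of any \<open>x\<close> outside
  \<open>G\<close>, so the sharp sum is the twisted sum for that \<open>x\<close> after
  reindexing.\<close>

lemma FSsharp_values:
  fixes Ghat (structure)
  assumes Ghat: "group Ghat" "finite (carrier Ghat)" and G: "subgroup G Ghat" and index: "card (rcosets G) = 2"
    and \<psi>: "\<psi> \<in> IrrSub Ghat G"
  shows "FSsharp Ghat G \<psi> \<in> {-1, 0, 1}"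
proof -
  interpret Ghat: group Ghat by fact
  interpret G: subgroup G Ghat by fact
  note [simp] = Ghat.m_assoc
  obtain x where x: "x \<in> sharp Ghat G" using index2_sharp_nonempty[OF Ghat(1) G index] by blast
  then have xc: "x \<in> carrier Ghat" "x \<notin> G" by (auto simp: sharp_def)
  note sharp = index2_sharp_eq[OF Ghat(1) G index x]
  have in_G: "y \<otimes> inv x \<in> G" if "y \<in> carrier Ghat" "y \<notin> G" for y
  proof -
    have "y \<in> sharp Ghat G" using that by (simp add: sharp_def)
    then obtain h where "h \<in> G" "y = h \<otimes> x" unfolding sharp by (rule imageE)
    then show ?thesis using xc by simp
  qed
  \<comment> \<open>Otherwise \<open>in_G\<close> would put
    \<open>x \<otimes> x \<otimes> inv x\<close>, which is \<open>x\<close>, into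
    \<open>G\<close>.\<close>
  have xx: "x \<otimes> x \<in> G"
    using in_G[of "x \<otimes> x"] xc by auto
  have "x \<otimes> g \<otimes> inv x \<in> G" if g: "g \<in> G" for g
  proof (rule in_G)
    show "x \<otimes> g \<notin> G"
    proof
      assume "x \<otimes> g \<in> G"
      then have "x \<otimes> g \<otimes> inv g \<in> G" by (rule G.m_closed) (use g in simp)
      moreover have "x \<otimes> g \<otimes> inv g = x" using g xc by simp
      ultimately show False using xc by metis
    qed
  qed (use xc g in auto)
  then have "(\<Sum>h\<in>G. \<psi> ((h \<otimes> x) [^] (2::nat))) / of_nat (card G) \<in> {-1, 0, 1}"
    by (rule twisted_indicator_values[OF Ghat G xc(1) xx _ \<psi>])
  moreover have "inj_on (\<lambda>h. h \<otimes> x) G" using xc by (auto simp: inj_on_def)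
  ultimately show ?thesis by (simp add: FSsharp_def sharp sum.reindex)
qed

section \<open>Degrees and positive elements of the multisets\<close>

text \<open>The value at the identity is the trace of an identity matrix. Its positivity ensures
  that dividing an indicator by it keeps the sign.\<close>

lemma IrrSub_one:
  assumes "group Ghat" "subgroup G Ghat" "\<psi> \<in> IrrSub Ghat G"
  obtains n where "n > 0" "\<psi> \<one>\<^bsub>Ghat\<^esub> = of_nat n"
proof -
  interpret Ghat: group Ghat by fact
  interpret G: subgroup G Ghat by fact
  define H where "H = Ghat\<lparr>carrier := G\<rparr>"
  have H: "group H" unfolding H_def by (rule G.subgroup_is_group[OF assms(1)])
  obtain n \<rho> where irr: "irreducible_representation H n \<rho>" and \<psi>_eq: "\<psi> = (\<lambda>g\<in>G. mat_trace (\<rho> g))"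
    using assms(3) by (auto simp: IrrSub_def Irr_def H_def)
  have "\<rho> \<one>\<^bsub>H\<^esub> = 1\<^sub>m n"
    by (rule representation_one[OF H irreducible_representationD(1)[OF irr]])
  then have "\<psi> \<one>\<^bsub>Ghat\<^esub> = of_nat n"
    using mat_trace_smult_one[of 1 n] by (simp add: \<psi>_eq H_def mat_trace_def)
  then show thesis using that irreducible_representationD(2)[OF irr] by blast
qed

text \<open>Finiteness is essential: \<open>mset_set\<close> of an infinite set is empty. This is
  what \<open>finite_Irr\<close> is for.\<close>

lemma num_positive_image_mset_set:
  "finite Y \<Longrightarrow> num_positive {# f y. y \<in># mset_set Y #} = card {y \<in> Y. f y \<in> \<real> \<and> Re (f y) > 0}"
  by (simp add: num_positive_def filter_mset_image_mset)

lemma positive_sign_quotient_iff: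
  fixes s :: complex
  assumes "s \<in> {-1, 0, 1}" "n > 0"
  shows "s / of_nat n \<in> \<real> \<and> Re (s / of_nat n) > 0 \<longleftrightarrow> s = 1"
  using assms by (auto simp: complex_eq_iff complex_is_Real_iff)

subsection \<open>Independence of the linear forms\<close>

text \<open>A spanning set has at least as many elements as the dimension, so a spanning list of
  that length has no repetitions, and a spanning set of minimal size is independent.\<close>

lemma independent_family_if_spanning:
  fixes L :: "'v::euclidean_space list"
  assumes "length L = DIM('v)" "Basis \<subseteq> span (set L)"
  shows "independent_family L"
proof -
  have span: "UNIV \<subseteq> span (set L)"
    using span_minimal[OF assms(2) subspace_span] by simp
  then have "DIM('v) \<le> card (set L)"
    using dim_le_card[of UNIV "set L"] by simp
  then have card: "card (set L) = length L" using card_length[of L] assms(1) by simp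
  have "independent (set L)"
    using card_le_dim_spanning[of "set L" UNIV] span card assms(1) by simp
  with card show ?thesis by (simp add: independent_family_def card_distinct)
qed

text \<open>The indeterminates are recovered one after another in the order V, VI, I, IX, II, III,
  X, VIII; IV and VII are themselves members of the list.\<close>

lemma independent_forms:
  "independent_family
           [indet T_I + indet T_V + indet T_IX,
            indet T_I + indet T_IX,
            indet T_VII,
            indet T_III + indet T_X,
            indet T_IV,
            indet T_V + indet T_VI,
            indet T_I + indet T_II + indet T_VIII + indet T_IX,
            indet T_I + indet T_II + indet T_III,
            4 *\<^sub>R indet T_I + indet T_III + indet T_V,
            indet T_II + indet T_IX]" (is "independent_family ?L")
proof (rule independent_family_if_spanning)
  show "length ?L = DIM(real ^ tenfold)" by (simp add: UNIV_tenfold)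
  let ?S = "span (set ?L)"
  have L: "v \<in> ?S" if "v \<in> set ?L" for v using that by (rule span_base)
  have V: "indet T_V \<in> ?S"
  proof -
    have "(indet T_I + indet T_V + indet T_IX) - (indet T_I + indet T_IX) \<in> ?S"
      by (intro span_diff L) simp_all
    then show ?thesis by simp
  qed
  have VI: "indet T_VI \<in> ?S"
  proof -
    have "(indet T_V + indet T_VI) - indet T_V \<in> ?S" by (intro span_diff L V) simp_all
    then show ?thesis by simp
  qed
  have I: "indet T_I \<in> ?S"
  proof -
    \<comment> \<open>Removing V and then I + II + III from the form with coefficient 4 leaves 3 I -
      II. Subtracting I - II, the difference of two forms containing IX, leaves 2 I.\<close>
    have "(1/2) *\<^sub>R ((4 *\<^sub>R indet T_I + indet T_III + indet T_V) - indet T_V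
        - (indet T_I + indet T_II + indet T_III) - ((indet T_I + indet T_IX) - (indet T_II + indet T_IX))) \<in> ?S"
      by (intro span_diff span_scale L V) simp_all
    also have "(1/2) *\<^sub>R ((4 *\<^sub>R indet T_I + indet T_III + indet T_V) - indet T_V
        - (indet T_I + indet T_II + indet T_III) - ((indet T_I + indet T_IX) - (indet T_II + indet T_IX)))
        = indet T_I"
      by (simp add: Finite_Cartesian_Product.vec_eq_iff field_simps)
    finally show ?thesis .
  qed
  have IX: "indet T_IX \<in> ?S"
  proof -
    have "(indet T_I + indet T_IX) - indet T_I \<in> ?S" by (intro span_diff L I) simp_all
    then show ?thesis by simp
  qed
  have II: "indet T_II \<in> ?S"
  proof -
    have "(indet T_II + indet T_IX) - indet T_IX \<in> ?S" by (intro span_diff L IX) simp_all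
    then show ?thesis by simp
  qed
  have III: "indet T_III \<in> ?S"
  proof -
    have "(indet T_I + indet T_II + indet T_III) - indet T_I - indet T_II \<in> ?S"
      by (intro span_diff L I II) simp_all
    then show ?thesis by simp
  qed
  have X: "indet T_X \<in> ?S"
  proof -
    have "(indet T_III + indet T_X) - indet T_III \<in> ?S" by (intro span_diff L III) simp_all
    then show ?thesis by simp
  qed
  have VIII: "indet T_VIII \<in> ?S"
  proof -
    have "(indet T_I + indet T_II + indet T_VIII + indet T_IX) - indet T_IX - indet T_I - indet T_II \<in> ?S"
      by (intro span_diff L I II IX) simp_all
    then show ?thesis by simp
  qed
  have "indet T_IV \<in> ?S" "indet T_VII \<in> ?S" by (intro L; simp)+
  then have "indet t \<in> ?S" for t
    by (cases t) (simp_all only: I II III V VI VIII IX X)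
  then show "Basis \<subseteq> ?S" by (auto simp: Basis_vec_def indet_def)
qed

section \<open>Counting the characters of positive sign by type\<close>

theorem corollary3p5:
  fixes Ghat :: "('a, 'b) monoid_scheme" and G :: "'a set"
  assumes "group Ghat" and "finite (carrier Ghat)"
    and "subgroup G Ghat" and "card (rcosets\<^bsub>Ghat\<^esub> G) = 2"
  shows "num_type Ghat G T_I + num_type Ghat G T_V + num_type Ghat G T_IX = S_v Ghat G
       \<and> num_type Ghat G T_I + num_type Ghat G T_IX = S_w Ghat G
       \<and> independent_family
           [indet T_I + indet T_V + indet T_IX,
            indet T_I + indet T_IX,
            indet T_VII,
            indet T_III + indet T_X,
            indet T_IV,
            indet T_V + indet T_VI,
            indet T_I + indet T_II + indet T_VIII + indet T_IX,
            indet T_I + indet T_II + indet T_III,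
            4 *\<^sub>R indet T_I + indet T_III + indet T_V,
            indet T_II + indet T_IX]"
proof (intro conjI independent_forms)
  interpret G: subgroup G Ghat by fact
  let ?Y = "IrrSub Ghat G"
  let ?F = "FS Ghat G" and ?F' = "FSsharp Ghat G"
  have "finite G" using assms(2) G.subset finite_subset by blast
  then have fin: "finite ?Y"
    unfolding IrrSub_def using G.subgroup_is_group[OF assms(1)] by (intro finite_Irr) auto
  have F: "?F \<psi> \<in> {-1, 0, 1}" "?F' \<psi> \<in> {-1, 0, 1}" if "\<psi> \<in> ?Y" for \<psi>
    using FS_values[OF assms(1-3) that] FSsharp_values[OF assms that] by auto
  have pos: "s / \<psi> \<one>\<^bsub>Ghat\<^esub> \<in> \<real> \<and> Re (s / \<psi> \<one>\<^bsub>Ghat\<^esub>) > 0 \<longleftrightarrow> s = 1"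
    if "\<psi> \<in> ?Y" "s \<in> {-1, 0, 1}" for s \<psi>
    using IrrSub_one[OF assms(1,3) that(1)] positive_sign_quotient_iff[OF that(2)] by metis
  have card: "num_type Ghat G T = card {\<psi> \<in> ?Y. has_type Ghat G \<psi> T}" for T
    by (simp add: num_type_def)
  have "S_v Ghat G = card {\<psi> \<in> ?Y. ?F' \<psi> = 1}"
    unfolding S_v_def X_v_def num_positive_image_mset_set[OF fin] using pos F
    by (intro arg_cong[where f = card]) blast
  \<comment> \<open>Types I, V and IX are the cases 1, 0 and -1 of \<open>?F \<psi>\<close> when the
    sharp indicator is 1; the restriction on the values of \<open>?F\<close> makes the list
    exhaustive.\<close>
  also have "{\<psi> \<in> ?Y. ?F' \<psi> = 1} = {\<psi> \<in> ?Y. has_type Ghat G \<psi> T_I}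
      \<union> {\<psi> \<in> ?Y. has_type Ghat G \<psi> T_V} \<union> {\<psi> \<in> ?Y. has_type Ghat G \<psi> T_IX}"
    using F(1) by auto
  also have "card \<dots> = num_type Ghat G T_I + num_type Ghat G T_V + num_type Ghat G T_IX"
    unfolding card using fin by (subst card_Un_disjoint, auto)+
  finally show "num_type Ghat G T_I + num_type Ghat G T_V + num_type Ghat G T_IX = S_v Ghat G" ..
  have F2: "(?F \<psi>)\<^sup>2 * ?F' \<psi> \<in> {-1, 0, 1}" if "\<psi> \<in> ?Y" for \<psi>
    using F[OF that] by auto
  have "S_w Ghat G = card {\<psi> \<in> ?Y. (?F \<psi>)\<^sup>2 * ?F' \<psi> = 1}"
    unfolding S_w_def X_w_def num_positive_image_mset_set[OF fin] using pos F2
    by (intro arg_cong[where f = card]) blast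
  \<comment> \<open>The square removes the characters with \<open>?F \<psi> = 0\<close>, in
    particular type V, and is 1 on all others, so only types I and IX remain.\<close>
  also have "{\<psi> \<in> ?Y. (?F \<psi>)\<^sup>2 * ?F' \<psi> = 1}
      = {\<psi> \<in> ?Y. has_type Ghat G \<psi> T_I} \<union> {\<psi> \<in> ?Y. has_type Ghat G \<psi> T_IX}"
    using F by force
  also have "card \<dots> = num_type Ghat G T_I + num_type Ghat G T_IX"
    unfolding card using fin by (subst card_Un_disjoint) auto
  finally show "num_type Ghat G T_I + num_type Ghat G T_IX = S_w Ghat G" ..
qed

end
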